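(* Let $b<c$ be real numbers. There exist boundary conditions $x_0,x_1\in\mathbb{R}^2$ with $x_0\neq x_1$ and $v_0,v_1\in\mathbb{R}^2\setminus\{0\}$ such that the cost $$J[\gamma]=\int_b^c \sqrt{\|\dot\gamma(t)\|^2+\|\dot\gamma(t)\|^2K_\gamma^2(t)}\,dt$$ does not admit a minimum over the set $$\mathcal{D}_1:=\{\gamma\in C^2([b,c],\mathbb{R}^2)\ :\ \dot\gamma(t)\neq 0\ \forall t\in[b,c],\ \gamma(b)=x_0,\ \gamma(c)=x_1,\ \dot\gamma(b)\sim v_0,\ \dot\gamma(c)\sim v_1\}.$$
   Context: For a planar curve $\gamma(t)=(x(t),y(t))$, the curvature at a time $t$ with $\dot\gamma(t)\neq0$ is $K_\gamma(t)=\dfrac{\dot x\ddot y-\dot y\ddot x}{(\dot x^2+\dot y^2)^{3/2}}$. For vectors $w_1,w_2\in\mathbb{R}^2$, $w_1\sim w_2$ means that there exists $\alpha>0$ with $w_1=\alpha w_2$ (same direction and same orientation). The norm $\|\cdot\|$ is the Euclidean norm. *)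

theory Defs
  imports "HOL-Analysis.Analysis"
begin

text \<open>Curves are total functions of which only the values on \<open>{b..c}\<close> matter: derivatives are taken
  within \<open>{b..c}\<close>, hence are one-sided at the two endpoints.\<close>

definition velocity :: "real \<Rightarrow> real \<Rightarrow> (real \<Rightarrow> real^2) \<Rightarrow> real \<Rightarrow> real^2" where
  "velocity b c \<gamma> t = vector_derivative \<gamma> (at t within {b..c})"

definition acceleration :: "real \<Rightarrow> real \<Rightarrow> (real \<Rightarrow> real^2) \<Rightarrow> real \<Rightarrow> real^2" where
  "acceleration b c \<gamma> t = vector_derivative (velocity b c \<gamma>) (at t within {b..c})"

definition C2_curve :: "real \<Rightarrow> real \<Rightarrow> (real \<Rightarrow> real^2) \<Rightarrow> bool" where
  "C2_curve b c \<gamma> \<longleftrightarrow>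
     (\<forall>t\<in>{b..c}. \<gamma> differentiable (at t within {b..c})) \<and>
     (\<forall>t\<in>{b..c}. velocity b c \<gamma> differentiable (at t within {b..c})) \<and>
     continuous_on {b..c} (acceleration b c \<gamma>)"

definition curvature :: "real \<Rightarrow> real \<Rightarrow> (real \<Rightarrow> real^2) \<Rightarrow> real \<Rightarrow> real" where
  "curvature b c \<gamma> t =
     (velocity b c \<gamma> t $ 1 * acceleration b c \<gamma> t $ 2 - velocity b c \<gamma> t $ 2 * acceleration b c \<gamma> t $ 1)
     / ((velocity b c \<gamma> t $ 1)\<^sup>2 + (velocity b c \<gamma> t $ 2)\<^sup>2) powr (3/2)"

definition same_direction :: "real^2 \<Rightarrow> real^2 \<Rightarrow> bool" (infix "\<sim>\<^sub>d" 50) where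
  "w1 \<sim>\<^sub>d w2 \<longleftrightarrow> (\<exists>\<alpha>>0. w1 = \<alpha> *\<^sub>R w2)"

definition cost :: "real \<Rightarrow> real \<Rightarrow> (real \<Rightarrow> real^2) \<Rightarrow> real" where
  "cost b c \<gamma> =
     integral {b..c} (\<lambda>t. sqrt ((norm (velocity b c \<gamma> t))\<^sup>2
                              + (norm (velocity b c \<gamma> t))\<^sup>2 * (curvature b c \<gamma> t)\<^sup>2))"

definition admissible_curves ::
    "real \<Rightarrow> real \<Rightarrow> real^2 \<Rightarrow> real^2 \<Rightarrow> real^2 \<Rightarrow> real^2 \<Rightarrow> (real \<Rightarrow> real^2) set" where
  "admissible_curves b c x0 x1 v0 v1 =
     {\<gamma>. C2_curve b c \<gamma> \<and> (\<forall>t\<in>{b..c}. velocity b c \<gamma> t \<noteq> 0) \<and>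
          \<gamma> b = x0 \<and> \<gamma> c = x1 \<and>
          velocity b c \<gamma> b \<sim>\<^sub>d v0 \<and> velocity b c \<gamma> c \<sim>\<^sub>d v1}"

end

theory Submission
  imports Defs
begin

text \<open>With \<open>\<theta>\<close> the direction angle of the velocity and \<open>u\<close> its norm, the cost is
  \<open>\<integral> sqrt (u\<^sup>2 + \<theta>'\<^sup>2)\<close>.  The function \<open>W = y + sin \<theta>\<close> is a calibration: by Cauchy--Schwarz
  \<open>W' = u sin \<theta> + \<theta>' cos \<theta> \<le> sqrt (u\<^sup>2 + \<theta>'\<^sup>2)\<close>, with equality only if \<open>u cos \<theta> = \<theta>' sin \<theta>\<close>.
  When the prescribed initial direction is \<open>\<theta> = 0\<close>, equality at the initial time would force
  \<open>u = 0\<close>, so every admissible curve costs strictly more than the increment of \<open>W\<close>.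
  The curve with \<open>u = \<theta>' tan \<theta>\<close>, \<open>\<theta>\<close> running from 0 to 1, attains this bound but has velocity zero
  at its start.  Adding to \<open>u\<close> a small function that is positive at \<open>\<theta> = 0\<close> and orthogonal to \<open>cos \<theta>\<close> and
  \<open>sin \<theta>\<close> keeps the end points and gives admissible curves whose cost tends to the bound.\<close>

section \<open>Plane vectors and the cost integrand\<close>

lemma norm_real2_sq: "(norm (w :: real^2))\<^sup>2 = (w $ 1)\<^sup>2 + (w $ 2)\<^sup>2"
  unfolding power2_norm_eq_inner inner_vec_def sum_2 by (simp add: power2_eq_square)

lemma vector2_eq_axis: "(vector [x, y] :: real^2) = x *\<^sub>R axis 1 1 + y *\<^sub>R axis 2 1"
  by (simp add: vec_eq_iff forall_2 axis_def)

lemma has_vector_derivative_vector2: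
  assumes "(f has_real_derivative f') F" "(g has_real_derivative g') F"
  shows "((\<lambda>t. vector [f t, g t] :: real^2) has_vector_derivative vector [f', g']) F"
  unfolding vector2_eq_axis
  by (intro has_vector_derivative_add bounded_linear.has_vector_derivative[OF bounded_linear_scaleR_left])
    (use assms in \<open>simp_all add: has_real_derivative_iff_has_vector_derivative\<close>)

lemma has_real_derivative_vec_nth:
  assumes "(f has_vector_derivative f') F"
  shows "((\<lambda>t. f t $ i) has_real_derivative f' $ i) F"
  using bounded_linear.has_vector_derivative[OF bounded_linear_vec_nth assms, of i]
  by (simp add: has_real_derivative_iff_has_vector_derivative)

lemma powr_three_halves: "0 < x \<Longrightarrow> (x\<^sup>2) powr (3/2) = x ^ 3" for x :: real
  by (simp add: powr_powr flip: powr_numeral)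

text \<open>The quotient on the right is the angular velocity \<theta>' of the velocity vector.
  Since the curvature is \<theta>' divided by the speed, the fractional power disappears.\<close>

lemma cost_integrand_eq:
  assumes "velocity b c \<gamma> t \<noteq> 0"
  shows "(norm (velocity b c \<gamma> t))\<^sup>2 * (curvature b c \<gamma> t)\<^sup>2 =
    ((velocity b c \<gamma> t $ 1 * acceleration b c \<gamma> t $ 2 - velocity b c \<gamma> t $ 2 * acceleration b c \<gamma> t $ 1)
      / (norm (velocity b c \<gamma> t))\<^sup>2)\<^sup>2"
proof -
  have n: "norm (velocity b c \<gamma> t) > 0" using assms by simp
  then have "norm (velocity b c \<gamma> t) * (x / norm (velocity b c \<gamma> t) ^ 3) = x / (norm (velocity b c \<gamma> t))\<^sup>2" for x
    by (simp add: power3_eq_cube power2_eq_square)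
  then show ?thesis
    unfolding curvature_def norm_real2_sq[symmetric] powr_three_halves[OF n] power_mult_distrib[symmetric]
    by simp
qed

section \<open>Strict lower bound by calibration\<close>

text \<open>With \<open>V = norm V * (cos \<theta>, sin \<theta>)\<close>, the two squared terms are
  the entries of the image of \<open>(norm V, w)\<close> under an orthogonal matrix, so the length
  is preserved. The first entry will be the derivative of the calibration, the second its defect
  from the integrand.\<close>

lemma calibration_identity:
  fixes V :: "real^2"
  assumes "V \<noteq> 0"
  shows "(norm V)\<^sup>2 + w\<^sup>2 =
    (V $ 2 + V $ 1 / norm V * w)\<^sup>2 + (V $ 1 - V $ 2 / norm V * w)\<^sup>2"
proof -
  define a where "a = V $ 1 / norm V"
  define b where "b = V $ 2 / norm V"
  have V: "V $ 1 = a * norm V" "V $ 2 = b * norm V"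
    using assms by (simp_all add: a_def b_def)
  have "(norm V)\<^sup>2 = (a\<^sup>2 + b\<^sup>2) * (norm V)\<^sup>2"
    using norm_real2_sq[of V] unfolding V by (simp add: power_mult_distrib distrib_right)
  then have ab: "a\<^sup>2 + b\<^sup>2 = 1" using assms by simp
  have "(V $ 2 + a * w)\<^sup>2 + (V $ 1 - b * w)\<^sup>2 = (a\<^sup>2 + b\<^sup>2) * ((norm V)\<^sup>2 + w\<^sup>2)"
    unfolding V by (simp add: power2_eq_square algebra_simps)
  then show ?thesis unfolding ab by (simp add: a_def b_def)
qed

lemma cost_gt_calibration:
  assumes "b < c" and C2: "C2_curve b c \<gamma>"
    and nz: "\<And>t. t \<in> {b..c} \<Longrightarrow> velocity b c \<gamma> t \<noteq> 0"
    and start: "velocity b c \<gamma> b $ 1 \<noteq> 0" "velocity b c \<gamma> b $ 2 = 0"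
  shows "cost b c \<gamma> > (\<gamma> c $ 2 - \<gamma> b $ 2) +
    (velocity b c \<gamma> c $ 2 / norm (velocity b c \<gamma> c) - velocity b c \<gamma> b $ 2 / norm (velocity b c \<gamma> b))"
proof -
  define V where "V = velocity b c \<gamma>"
  define A where "A = acceleration b c \<gamma>"
  define w where "w t = (V t $ 1 * A t $ 2 - V t $ 2 * A t $ 1) / (norm (V t))\<^sup>2" for t
  define W' where "W' t = V t $ 2 + V t $ 1 / norm (V t) * w t" for t
  define f where "f t = sqrt ((norm (V t))\<^sup>2 + (w t)\<^sup>2)" for t
  have V: "(\<gamma> has_vector_derivative V t) (at t within {b..c})" if "t \<in> {b..c}" for t
    using C2 that unfolding C2_curve_def V_def velocity_def
    by (simp flip: vector_derivative_works)
  have A: "(V has_vector_derivative A t) (at t within {b..c})" if "t \<in> {b..c}" for t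
    using C2 that unfolding C2_curve_def A_def acceleration_def V_def
    by (simp flip: vector_derivative_works)
  have Vpos: "norm (V t) > 0" if "t \<in> {b..c}" for t
    using nz[OF that] by (simp add: V_def)
  have contV: "continuous_on {b..c} V"
    using A by (meson continuous_on_vector_derivative)
  have contA: "continuous_on {b..c} A"
    using C2 by (simp add: C2_curve_def A_def)
  have contw: "continuous_on {b..c} w"
    unfolding w_def using Vpos
    by (intro continuous_intros contV contA) force
  have contf: "continuous_on {b..c} f"
    unfolding f_def by (intro continuous_intros contV contw)
  have contW': "continuous_on {b..c} W'"
    unfolding W'_def using Vpos by (intro continuous_intros contV contw) force
  have cost: "cost b c \<gamma> = integral {b..c} f"
    unfolding cost_def
    by (rule integral_cong) (simp add: cost_integrand_eq nz f_def w_def V_def A_def)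
  have f_sq: "(f t)\<^sup>2 = (W' t)\<^sup>2 + (V t $ 1 - V t $ 2 / norm (V t) * w t)\<^sup>2" if "t \<in> {b..c}" for t
    using calibration_identity[of "V t" "w t"] nz[OF that]
    by (simp add: f_def W'_def V_def)
  have le: "W' t \<le> f t" if "t \<in> {b..c}" for t
  proof (rule power2_le_imp_le)
    show "(W' t)\<^sup>2 \<le> (f t)\<^sup>2" using f_sq[OF that] by simp
  qed (simp add: f_def)
  \<comment> \<open>At \<open>b\<close> the second component of \<open>V\<close> vanishes, so the
    defect is \<open>V b $ 1\<close>, which is nonzero.\<close>
  have neq: "W' b \<noteq> f b"
  proof
    assume "W' b = f b"
    then have "V b $ 1 - V b $ 2 / norm (V b) * w b = 0"
      using f_sq[of b] \<open>b < c\<close> by simp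
    then show False using start by (simp add: V_def)
  qed
  \<comment> \<open>Writing sin \<theta> as \<open>V t $ 2 / norm (V t)\<close> avoids choosing a
    continuous angle along the curve.\<close>
  have W_deriv: "((\<lambda>t. \<gamma> t $ 2 + V t $ 2 / norm (V t)) has_real_derivative W' t) (at t within {b..c})"
    if t: "t \<in> {b..c}" for t
  proof -
    note n = Vpos[OF t]
    have norm_eq: "norm (V t) = sqrt ((V t $ 1)\<^sup>2 + (V t $ 2)\<^sup>2)" for t
      by (simp add: norm_real2_sq[symmetric])
    have pos: "(V t $ 1)\<^sup>2 + (V t $ 2)\<^sup>2 > 0"
      using n by (simp add: norm_real2_sq[symmetric])
    have "((\<lambda>t. (V t $ 1)\<^sup>2 + (V t $ 2)\<^sup>2) has_real_derivative
        2 * (V t $ 1 * A t $ 1 + V t $ 2 * A t $ 2)) (at t within {b..c})"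
      using DERIV_add[OF DERIV_power[OF has_real_derivative_vec_nth[OF A[OF t], of 1], of 2]
          DERIV_power[OF has_real_derivative_vec_nth[OF A[OF t], of 2], of 2]]
      by (simp add: algebra_simps)
    then have "((\<lambda>t. sqrt ((V t $ 1)\<^sup>2 + (V t $ 2)\<^sup>2)) has_real_derivative
        inverse (sqrt ((V t $ 1)\<^sup>2 + (V t $ 2)\<^sup>2)) / 2 * (2 * (V t $ 1 * A t $ 1 + V t $ 2 * A t $ 2)))
        (at t within {b..c})"
      using DERIV_real_sqrt[OF pos]
      by (rule DERIV_chain'[where g = sqrt and f = "\<lambda>t. (V t $ 1)\<^sup>2 + (V t $ 2)\<^sup>2"])
    moreover have "inverse x / 2 * (2 * y) = y / x" for x y :: real
      by (simp add: field_simps)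
    ultimately have N: "((\<lambda>t. norm (V t)) has_real_derivative
        (V t $ 1 * A t $ 1 + V t $ 2 * A t $ 2) / norm (V t)) (at t within {b..c})"
      by (simp only: norm_eq)
    have eq: "W' t = V t $ 2 + (A t $ 2 * norm (V t) -
        V t $ 2 * ((V t $ 1 * A t $ 1 + V t $ 2 * A t $ 2) / norm (V t))) / (norm (V t) * norm (V t))"
    proof -
      have "A t $ 2 * norm (V t) - V t $ 2 * ((V t $ 1 * A t $ 1 + V t $ 2 * A t $ 2) / norm (V t))
        = (A t $ 2 * (norm (V t))\<^sup>2 - V t $ 2 * (V t $ 1 * A t $ 1 + V t $ 2 * A t $ 2)) / norm (V t)"
        using n by (simp add: diff_divide_distrib power2_eq_square)
      also have "A t $ 2 * (norm (V t))\<^sup>2 - V t $ 2 * (V t $ 1 * A t $ 1 + V t $ 2 * A t $ 2)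
        = V t $ 1 * (V t $ 1 * A t $ 2 - V t $ 2 * A t $ 1)"
        unfolding norm_real2_sq by (simp add: algebra_simps power2_eq_square)
      finally show ?thesis
        by (simp add: W'_def w_def power2_eq_square mult_ac)
    qed
    show ?thesis
      unfolding eq
      by (intro DERIV_add DERIV_divide has_real_derivative_vec_nth[OF V[OF t]]
          has_real_derivative_vec_nth[OF A[OF t]] N) (use n in simp)
  qed
  have intW: "(W' has_integral (\<gamma> c $ 2 + V c $ 2 / norm (V c)) - (\<gamma> b $ 2 + V b $ 2 / norm (V b))) {b..c}"
    using W_deriv \<open>b < c\<close>
    by (intro fundamental_theorem_of_calculus)
      (simp_all add: has_real_derivative_iff_has_vector_derivative)
  \<comment> \<open>Strictness at the single time \<open>b\<close> suffices: if the integrals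
    agreed, the continuous nonnegative function \<open>f - W'\<close> would vanish on all of
    \<open>{b..c}\<close>.\<close>
  have "integral {b..c} W' < integral {b..c} f"
  proof (rule ccontr)
    assume "\<not> ?thesis"
    moreover have "integral {b..c} W' \<le> integral {b..c} f"
      by (intro integral_le integrable_continuous_real contW' contf le)
    ultimately have eq: "integral {b..c} (\<lambda>t. f t - W' t) = 0"
      by (simp add: Henstock_Kurzweil_Integration.integral_diff integrable_continuous_real contf contW')
    have "f b - W' b = 0"
    proof (rule has_integral_0_cbox_imp_0[of b c "\<lambda>t. f t - W' t"])
      show "continuous_on (cbox b c) (\<lambda>t. f t - W' t)"
        by (simp add: continuous_on_diff contf contW')
      then have "(\<lambda>t. f t - W' t) integrable_on {b..c}"
        by (simp add: integrable_continuous_real)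
      then show "((\<lambda>t. f t - W' t) has_integral 0) (cbox b c)"
        using eq by (simp add: has_integral_integrable_integral)
    qed (use le \<open>b < c\<close> in auto)
    then show False using neq by simp
  qed
  then show ?thesis
    using intW unfolding cost V_def by (simp add: integral_unique)
qed

section \<open>Curves given by speed and direction angle\<close>

text \<open>The acceleration has tangential part \<open>u'\<close> and normal part
  \<open>u * \<theta>'\<close>. Only the latter enters the cross product with the velocity, so the
  angular velocity in the integrand is exactly \<open>\<theta>'\<close>.\<close>

lemma curve_of_speed_angle:
  assumes "b < c"
    and \<gamma>: "\<And>t. t \<in> {b..c} \<Longrightarrow>
      (\<gamma> has_vector_derivative vector [u t * cos (\<theta> t), u t * sin (\<theta> t)]) (at t within {b..c})"
    and u: "\<And>t. t \<in> {b..c} \<Longrightarrow> (u has_real_derivative u' t) (at t within {b..c})"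
    and \<theta>: "\<And>t. t \<in> {b..c} \<Longrightarrow> (\<theta> has_real_derivative \<theta>' t) (at t within {b..c})"
    and cont: "continuous_on {b..c} u'" "continuous_on {b..c} \<theta>'"
    and pos: "\<And>t. t \<in> {b..c} \<Longrightarrow> u t > 0"
  shows "C2_curve b c \<gamma>"
    and "t \<in> {b..c} \<Longrightarrow> velocity b c \<gamma> t = vector [u t * cos (\<theta> t), u t * sin (\<theta> t)]"
    and "cost b c \<gamma> = integral {b..c} (\<lambda>t. sqrt ((u t)\<^sup>2 + (\<theta>' t)\<^sup>2))"
proof -
  define A :: "real \<Rightarrow> real^2" where "A t = vector [u' t * cos (\<theta> t) - u t * sin (\<theta> t) * \<theta>' t,
    u' t * sin (\<theta> t) + u t * cos (\<theta> t) * \<theta>' t]" for t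
  have V: "velocity b c \<gamma> t = vector [u t * cos (\<theta> t), u t * sin (\<theta> t)]" if "t \<in> {b..c}" for t
    unfolding velocity_def using vector_derivative_within_closed_interval[OF \<open>b < c\<close> that \<gamma>[OF that]] .
  then show "t \<in> {b..c} \<Longrightarrow> velocity b c \<gamma> t = vector [u t * cos (\<theta> t), u t * sin (\<theta> t)]" .
  have VA: "(velocity b c \<gamma> has_vector_derivative A t) (at t within {b..c})" if t: "t \<in> {b..c}" for t
  proof (rule has_vector_derivative_transform[OF t V])
    show "((\<lambda>t. vector [u t * cos (\<theta> t), u t * sin (\<theta> t)]) has_vector_derivative A t) (at t within {b..c})"
      unfolding A_def
      by (rule has_vector_derivative_vector2; (rule derivative_eq_intros u[OF t] \<theta>[OF t] refl)+; simp)
  qed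
  have A: "acceleration b c \<gamma> t = A t" if "t \<in> {b..c}" for t
    unfolding acceleration_def using vector_derivative_within_closed_interval[OF \<open>b < c\<close> that VA[OF that]] .
  have "continuous_on {b..c} u" "continuous_on {b..c} \<theta>"
    using u \<theta> by (blast intro: DERIV_continuous_on)+
  then have "continuous_on {b..c} A"
    unfolding A_def vector2_eq_axis by (intro continuous_intros cont)
  then have "continuous_on {b..c} (acceleration b c \<gamma>)"
    by (rule continuous_on_eq) (simp add: A)
  then show "C2_curve b c \<gamma>"
    unfolding C2_curve_def using \<gamma> VA by (blast intro: differentiableI_vector)
  have norm_V: "(norm (velocity b c \<gamma> t))\<^sup>2 = (u t)\<^sup>2" if "t \<in> {b..c}" for t
    by (simp add: norm_real2_sq V[OF that] power_mult_distrib flip: distrib_left)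
  show "cost b c \<gamma> = integral {b..c} (\<lambda>t. sqrt ((u t)\<^sup>2 + (\<theta>' t)\<^sup>2))"
    unfolding cost_def
  proof (rule integral_cong)
    fix t assume t: "t \<in> {b..c}"
    have "velocity b c \<gamma> t $ 1 * acceleration b c \<gamma> t $ 2 - velocity b c \<gamma> t $ 2 * acceleration b c \<gamma> t $ 1
      = (u t)\<^sup>2 * \<theta>' t * ((cos (\<theta> t))\<^sup>2 + (sin (\<theta> t))\<^sup>2)"
      unfolding V[OF t] A[OF t] A_def
      by (simp add: algebra_simps power2_eq_square del: sin_cos_squared_add2 sin_cos_squared_add3)
    then have num: "velocity b c \<gamma> t $ 1 * acceleration b c \<gamma> t $ 2 -
        velocity b c \<gamma> t $ 2 * acceleration b c \<gamma> t $ 1 = (u t)\<^sup>2 * \<theta>' t"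
      by simp
    have nz: "velocity b c \<gamma> t \<noteq> 0"
      using norm_V[OF t] pos[OF t] by auto
    show "sqrt ((norm (velocity b c \<gamma> t))\<^sup>2 + (norm (velocity b c \<gamma> t))\<^sup>2 * (curvature b c \<gamma> t)\<^sup>2)
      = sqrt ((u t)\<^sup>2 + (\<theta>' t)\<^sup>2)"
      unfolding cost_integrand_eq[OF nz]
      unfolding num norm_V[OF t] using pos[OF t] by simp
  qed
qed

section \<open>The perturbed family on the unit interval\<close>

text \<open>The perturbation \<open>h n + h' T\<close> with \<open>T = (cos s, sin s)\<close>, \<open>n = (sin s, - cos s)\<close> has derivative
  \<open>(h + h'') T\<close>, so it changes only the speed; taking \<open>h = s\<^sup>2 (1 - s)\<^sup>2\<close> makes it vanish at both ends.\<close>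

definition bump :: "real \<Rightarrow> real" where
  "bump s = s\<^sup>2 * (1 - s)\<^sup>2"

definition bump' :: "real \<Rightarrow> real" where
  "bump' s = 2 * s * (1 - s) * (1 - 2 * s)"

definition bump'' :: "real \<Rightarrow> real" where
  "bump'' s = 2 - 12 * s + 12 * s\<^sup>2"

text \<open>For \<open>e = 0\<close>, \<open>family_x\<close> and \<open>family_y\<close> integrate
  sin s and tan s sin s = sec s - cos s from 0, giving the curve of speed tan s in direction s from
  the origin. The logarithms in \<open>family_y\<close> form the antiderivative of sec s.\<close>

definition family_x :: "real \<Rightarrow> real \<Rightarrow> real" where
  "family_x e s = 1 - cos s + e * (bump s * sin s + bump' s * cos s)"

definition family_y :: "real \<Rightarrow> real \<Rightarrow> real" where
  "family_y e s = ln (1 + sin s) - ln (cos s) - sin s + e * (bump' s * sin s - bump s * cos s)"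

definition family_speed :: "real \<Rightarrow> real \<Rightarrow> real" where
  "family_speed e s = tan s + e * (bump s + bump'' s)"

lemma bump_deriv [derivative_intros]:
  "(f has_real_derivative f') F \<Longrightarrow> F = at x within S \<Longrightarrow>
    ((\<lambda>t. bump (f t)) has_real_derivative bump' (f x) * f') F"
  "(f has_real_derivative f') F \<Longrightarrow> F = at x within S \<Longrightarrow>
    ((\<lambda>t. bump' (f t)) has_real_derivative bump'' (f x) * f') F"
  unfolding bump_def bump'_def bump''_def
  by (auto intro!: derivative_eq_intros simp: power2_eq_square algebra_simps)

lemma unit_interval_trig:
  assumes "s \<in> {0..1::real}"
  shows "cos s > 0" "sin s \<ge> 0"
proof -
  have "s < pi / 2" "0 \<le> s" using assms pi_gt3 by auto
  then show "cos s > 0" "sin s \<ge> 0"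
    by (auto intro!: cos_gt_zero_pi sin_ge_zero)
qed

lemma has_real_derivative_ln_sec:
  assumes "s \<in> {0..1::real}"
  shows "((\<lambda>s. ln (1 + sin s) - ln (cos s)) has_real_derivative 1 / cos s) (at s)"
proof -
  note pos = unit_interval_trig[OF assms]
  have "cos s / (1 + sin s) + sin s / cos s
    = ((cos s)\<^sup>2 + (sin s)\<^sup>2 + sin s) / ((1 + sin s) * cos s)"
    using pos by (simp add: add_divide_eq_iff divide_add_eq_iff power2_eq_square field_simps)
  also have "\<dots> = 1 / cos s" using pos by simp
  finally have eq: "cos s / (1 + sin s) + sin s / cos s = 1 / cos s" .
  show ?thesis
    by (rule derivative_eq_intros refl | use pos eq in \<open>simp add: field_simps\<close>)+
qed

lemma family_deriv:
  assumes s: "s \<in> {0..1::real}"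
  shows "(family_x e has_real_derivative family_speed e s * cos s) (at s)"
    and "(family_y e has_real_derivative family_speed e s * sin s) (at s)"
proof -
  note pos = unit_interval_trig[OF s]
  show "(family_x e has_real_derivative family_speed e s * cos s) (at s)"
    unfolding family_x_def[abs_def] family_speed_def tan_def
    by (rule derivative_eq_intros refl)+ (use pos in \<open>simp add: field_simps\<close>)
  have "1 / cos s - cos s = (1 - (cos s)\<^sup>2) / cos s"
    using pos by (simp add: field_simps power2_eq_square)
  then have "1 / cos s - cos s = tan s * sin s"
    unfolding sin_squared_eq[symmetric] by (simp add: tan_def power2_eq_square)
  then show "(family_y e has_real_derivative family_speed e s * sin s) (at s)"
    unfolding family_y_def[abs_def] family_speed_def
    by - (rule derivative_eq_intros has_real_derivative_ln_sec[OF s] refl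
        | simp add: algebra_simps)+
qed

lemma family_ends:
  "family_x e 0 = 0" "family_x e 1 = 1 - cos 1"
  "family_y e 0 = 0" "family_y e 1 = ln (1 + sin 1) - ln (cos 1) - sin 1"
  by (simp_all add: family_x_def family_y_def bump_def bump'_def)

text \<open>\<open>bump''\<close> is negative in the middle of the interval, but there tan s \<ge> s
  compensates: the speed is at least s + e (2 - 12 s) = (1 - 12 e) s + 2 e. This is where the bound
  1/12 comes from.\<close>

lemma family_speed_pos:
  assumes s: "s \<in> {0..1::real}" and e: "0 < e" "e \<le> 1/12"
  shows "family_speed e s > 0"
proof -
  have "tan 0 - 0 \<le> tan s - s"
  proof (rule DERIV_nonneg_imp_nondecreasing[where f = "\<lambda>x. tan x - x"])
    fix x assume "0 \<le> x" "x \<le> s"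
    then have "cos x > 0" using unit_interval_trig(1)[of x] s by simp
    moreover have "(cos x)\<^sup>2 \<le> 1" by (simp add: abs_square_le_1)
    ultimately show "\<exists>y. ((\<lambda>x. tan x - x) has_real_derivative y) (at x) \<and> 0 \<le> y"
      by (intro exI[of _ "inverse ((cos x)\<^sup>2) - 1"])
        (auto intro!: derivative_eq_intros simp: one_le_inverse)
  qed (use s in simp)
  then have "s \<le> tan s" by simp
  moreover have "e * (bump s + bump'' s) \<ge> e * (2 - 12 * s)"
    using e by (intro mult_left_mono) (auto simp: bump_def bump''_def)
  moreover have "12 * e * s \<le> 1 * s"
    using s e by (intro mult_right_mono) auto
  ultimately show ?thesis
    using e by (simp add: family_speed_def algebra_simps)
qed

text \<open>The triangle inequality for (tan s, 1) + (e (h + h''), 0) with h = \<open>bump\<close>,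
  where the first vector has length sec s. The constant 15 is crude: \<open>bump\<close> is at most
  1 and \<open>bump''\<close> lies between -10 and 14.\<close>

lemma family_cost_bound:
  assumes s: "s \<in> {0..1::real}" and e: "0 < e"
  shows "sqrt ((family_speed e s)\<^sup>2 + 1) \<le> 1 / cos s + 15 * e"
proof -
  note pos = unit_interval_trig[OF s]
  have "1 / cos s = sqrt ((tan s)\<^sup>2 + 1)"
  proof (rule real_sqrt_unique[symmetric])
    show "(1 / cos s)\<^sup>2 = (tan s)\<^sup>2 + 1"
      using pos tan_sec[of s] by (simp add: inverse_eq_divide)
  qed (use pos in simp)
  moreover have "\<bar>bump s + bump'' s\<bar> \<le> 15"
  proof -
    have "s\<^sup>2 \<le> 1" "(1 - s)\<^sup>2 \<le> 1" using s by (auto simp: abs_square_le_1)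
    then have "0 \<le> bump s" "bump s \<le> 1" "0 \<le> s\<^sup>2"
      by (auto simp: bump_def mult_le_one)
    then show ?thesis
      using s \<open>s\<^sup>2 \<le> 1\<close> unfolding bump''_def abs_le_iff atLeastAtMost_iff by linarith
  qed
  then have "\<bar>e * (bump s + bump'' s)\<bar> \<le> 15 * e"
    using e by (simp add: abs_mult)
  moreover have "sqrt ((family_speed e s)\<^sup>2 + 1\<^sup>2)
      \<le> sqrt ((tan s)\<^sup>2 + 1\<^sup>2) + sqrt ((e * (bump s + bump'' s))\<^sup>2 + 0\<^sup>2)"
    using real_sqrt_sum_squares_triangle_ineq[of "tan s" "e * (bump s + bump'' s)" 1 0]
    by (simp add: family_speed_def)
  ultimately show ?thesis by simp
qed

section \<open>Admissible curves with cost near the bound\<close>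

text \<open>The family is transported to \<open>{b..c}\<close> by the affine map sending
  \<open>b\<close> to 0 and \<open>c\<close> to 1. Integrating the pointwise bound sec s + 15 e over
  the unit interval gives the estimate.\<close>

lemma approximating_curve:
  fixes b c e :: real
  assumes "b < c" and e: "0 < e" "e \<le> 1/12"
  shows "\<exists>\<eta>\<in>admissible_curves b c 0 (vector [1 - cos 1, ln (1 + sin 1) - ln (cos 1) - sin 1])
      (vector [1, 0]) (vector [cos 1, sin 1]).
    cost b c \<eta> \<le> ln (1 + sin 1) - ln (cos 1) + 15 * e"
proof -
  define k where "k = 1 / (c - b)"
  define \<theta> where "\<theta> t = k * (t - b)" for t
  define \<eta> :: "real \<Rightarrow> real^2" where "\<eta> t = vector [family_x e (\<theta> t), family_y e (\<theta> t)]" for t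
  define u where "u t = k * family_speed e (\<theta> t)" for t
  \<comment> \<open>One factor \<open>k\<close> comes from \<open>u\<close>, the other from the
    chain rule; \<open>24 * \<theta> t - 12\<close> is the derivative of
    \<open>bump''\<close>.\<close>
  define u' where "u' t = k * (k * (1 / (cos (\<theta> t))\<^sup>2 + e * (bump' (\<theta> t) + 24 * \<theta> t - 12)))" for t
  have k_c: "k * (c - b) = 1" using \<open>b < c\<close> by (simp add: k_def)
  have k: "k > 0" using \<open>b < c\<close> by (simp add: k_def)
  have ends: "\<theta> b = 0" "\<theta> c = 1" using \<open>b < c\<close> by (auto simp: \<theta>_def k_def)
  have \<theta>_range: "\<theta> t \<in> {0..1}" if "t \<in> {b..c}" for t
    using that \<open>b < c\<close> by (auto simp: \<theta>_def k_def field_simps)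
  have \<theta>_deriv: "(\<theta> has_real_derivative k) (at t within S)" for t S
    unfolding \<theta>_def by (auto intro!: derivative_eq_intros)
  note chain = DERIV_chain'[OF \<theta>_deriv]
  have \<eta>_deriv: "(\<eta> has_vector_derivative vector [u t * cos (\<theta> t), u t * sin (\<theta> t)]) (at t within {b..c})"
    if "t \<in> {b..c}" for t
    using has_vector_derivative_vector2[OF chain[OF family_deriv(1)] chain[OF family_deriv(2)]] \<theta>_range[OF that]
    unfolding \<eta>_def u_def by (auto simp: mult_ac)
  have u_deriv: "(u has_real_derivative u' t) (at t within {b..c})" if t: "t \<in> {b..c}" for t
    unfolding u_def u'_def family_speed_def bump''_def
    by (rule derivative_eq_intros \<theta>_deriv refl
        | use unit_interval_trig[OF \<theta>_range[OF t]] in \<open>simp add: field_simps\<close>)+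
  have cont_\<theta>: "continuous_on {b..c} \<theta>"
    unfolding \<theta>_def by (intro continuous_intros)
  have cont_u': "continuous_on {b..c} u'"
    unfolding u'_def bump'_def
    by (intro continuous_intros cont_\<theta>) (use unit_interval_trig[OF \<theta>_range] in force)
  have u_pos: "u t > 0" if "t \<in> {b..c}" for t
    using family_speed_pos[OF \<theta>_range[OF that] e] k by (simp add: u_def)
  note curve = curve_of_speed_angle[OF \<open>b < c\<close> \<eta>_deriv u_deriv \<theta>_deriv cont_u' continuous_on_const u_pos]
  have vel: "velocity b c \<eta> t = u t *\<^sub>R vector [cos (\<theta> t), sin (\<theta> t)]" if "t \<in> {b..c}" for t
    using curve(2)[OF _ _ _ that] by (simp add: vec_eq_iff forall_2)
  have "velocity b c \<eta> t \<noteq> 0" if "t \<in> {b..c}" for t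
    using vel[OF that] u_pos[OF that] unit_interval_trig(1)[OF \<theta>_range[OF that]]
    by (auto simp: vec_eq_iff forall_2)
  then have adm: "\<eta> \<in> admissible_curves b c 0 (vector [1 - cos 1, ln (1 + sin 1) - ln (cos 1) - sin 1])
      (vector [1, 0]) (vector [cos 1, sin 1])"
    using curve(1) vel[of b] vel[of c] u_pos[of b] u_pos[of c] \<open>b < c\<close>
    by (auto simp: admissible_curves_def same_direction_def ends family_ends \<eta>_def vec_eq_iff forall_2)
  have "((\<lambda>t. k / cos (\<theta> t)) has_integral (ln (1 + sin (\<theta> c)) - ln (cos (\<theta> c)))
      - (ln (1 + sin (\<theta> b)) - ln (cos (\<theta> b)))) {b..c}"
  proof (rule fundamental_theorem_of_calculus)
    fix t assume "t \<in> {b..c}"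
    from chain[OF has_real_derivative_ln_sec[OF \<theta>_range[OF this]]]
    show "((\<lambda>t. ln (1 + sin (\<theta> t)) - ln (cos (\<theta> t))) has_vector_derivative k / cos (\<theta> t)) (at t within {b..c})"
      by (simp add: has_real_derivative_iff_has_vector_derivative)
  qed (use \<open>b < c\<close> in simp)
  moreover have "((\<lambda>t. 15 * e * k) has_integral 15 * e * k * (c - b)) {b..c}"
    using has_integral_const_real[of "15 * e * k" b c] \<open>b < c\<close> by (simp add: mult_ac)
  ultimately have "((\<lambda>t. k / cos (\<theta> t) + 15 * e * k) has_integral
      (ln (1 + sin (\<theta> c)) - ln (cos (\<theta> c))) - (ln (1 + sin (\<theta> b)) - ln (cos (\<theta> b)))
      + 15 * e * k * (c - b)) {b..c}"
    by (rule has_integral_add)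
  then have bound: "((\<lambda>t. k / cos (\<theta> t) + 15 * e * k) has_integral
      ln (1 + sin 1) - ln (cos 1) + 15 * e) {b..c}"
    using k_c by (simp add: ends mult.assoc)
  have "continuous_on {b..c} u" using u_deriv by (rule DERIV_continuous_on)
  then have "(\<lambda>t. sqrt ((u t)\<^sup>2 + k\<^sup>2)) integrable_on {b..c}"
    by (intro integrable_continuous_real continuous_intros)
  then have "integral {b..c} (\<lambda>t. sqrt ((u t)\<^sup>2 + k\<^sup>2)) \<le> ln (1 + sin 1) - ln (cos 1) + 15 * e"
  proof (rule has_integral_le[OF integrable_integral bound])
    fix t assume t: "t \<in> {b..c}"
    \<comment> \<open>Speed and angular velocity both carry the factor \<open>k\<close>, so it can
      be pulled out of the root.\<close>
    have "(u t)\<^sup>2 + k\<^sup>2 = k\<^sup>2 * ((family_speed e (\<theta> t))\<^sup>2 + 1)"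
      by (simp add: u_def algebra_simps power_mult_distrib)
    then have "sqrt ((u t)\<^sup>2 + k\<^sup>2) = k * sqrt ((family_speed e (\<theta> t))\<^sup>2 + 1)"
      using k by (simp add: real_sqrt_mult)
    also have "\<dots> \<le> k * (1 / cos (\<theta> t) + 15 * e)"
      using family_cost_bound[OF \<theta>_range[OF t] e(1)] k by simp
    finally show "sqrt ((u t)\<^sup>2 + k\<^sup>2) \<le> k / cos (\<theta> t) + 15 * e * k"
      by (simp add: algebra_simps)
  qed
  then have "cost b c \<eta> \<le> ln (1 + sin 1) - ln (cos 1) + 15 * e"
    using curve(3) by simp
  then show ?thesis using adm by blast
qed

section \<open>The infimum is not attained\<close>

theorem proposition1:
  fixes b c :: real
  assumes "b < c"
  shows "\<exists>x0 x1 v0 v1 :: real^2.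
           x0 \<noteq> x1 \<and> v0 \<noteq> 0 \<and> v1 \<noteq> 0 \<and>
           \<not> (\<exists>\<gamma>\<in>admissible_curves b c x0 x1 v0 v1.
                \<forall>\<eta>\<in>admissible_curves b c x0 x1 v0 v1. cost b c \<gamma> \<le> cost b c \<eta>)"
proof -
  \<comment> \<open>\<open>L\<close> is the integral of sec over the unit interval, and also the
    increment of y + sin \<theta>: the end height \<open>L - sin 1\<close> plus the increment sin 1
    of sin \<theta>.\<close>
  define L :: real where "L = ln (1 + sin 1) - ln (cos 1)"
  define x1 v0 v1 :: "real^2" where "x1 = vector [1 - cos 1, L - sin 1]"
    and "v0 = vector [1, 0]" and "v1 = vector [cos 1, sin 1]"
  let ?D = "admissible_curves b c 0 x1 v0 v1"
  \<comment> \<open>The boundary velocities are known only up to positive factors, but the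
    calibration sees only the normalised velocity, whose second component is 0 at \<open>b\<close>
    and sin 1 at \<open>c\<close>.\<close>
  have lower: "L < cost b c \<gamma>" if mem: "\<gamma> \<in> ?D" for \<gamma>
  proof -
    have \<gamma>: "C2_curve b c \<gamma>" "\<And>t. t \<in> {b..c} \<Longrightarrow> velocity b c \<gamma> t \<noteq> 0" "\<gamma> b = 0" "\<gamma> c = x1"
      using mem by (auto simp: admissible_curves_def)
    obtain r s where "r > 0" "velocity b c \<gamma> b = r *\<^sub>R v0" "s > 0" "velocity b c \<gamma> c = s *\<^sub>R v1"
      using mem by (auto simp: admissible_curves_def same_direction_def)
    moreover have "norm v1 = 1"
      by (rule power2_eq_imp_eq) (simp_all add: norm_real2_sq v1_def)
    ultimately show ?thesis
      using cost_gt_calibration[OF assms \<gamma>(1,2)]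
      by (simp add: \<gamma>(3,4) x1_def v0_def v1_def)
  qed
  have "\<not> (\<exists>\<gamma>\<in>?D. \<forall>\<eta>\<in>?D. cost b c \<gamma> \<le> cost b c \<eta>)"
  proof
    assume "\<exists>\<gamma>\<in>?D. \<forall>\<eta>\<in>?D. cost b c \<gamma> \<le> cost b c \<eta>"
    then obtain \<gamma> where \<gamma>: "\<gamma> \<in> ?D" "\<And>\<eta>. \<eta> \<in> ?D \<Longrightarrow> cost b c \<gamma> \<le> cost b c \<eta>" by blast
    \<comment> \<open>With this \<open>e\<close>, \<open>L + 15 * e\<close> is at most the midpoint
      between \<open>L\<close> and the supposed minimum, hence strictly below that minimum.\<close>
    define e where "e = min (1/12) ((cost b c \<gamma> - L) / 30)"
    have e: "0 < e" "e \<le> 1/12" "30 * e \<le> cost b c \<gamma> - L"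
      using lower[OF \<gamma>(1)] by (auto simp: e_def min_def)
    obtain \<eta> where "\<eta> \<in> ?D" "cost b c \<eta> \<le> L + 15 * e"
      using approximating_curve[OF assms e(1,2)] by (auto simp: x1_def v0_def v1_def L_def)
    then show False using \<gamma>(2)[of \<eta>] e by linarith
  qed
  moreover have "0 \<noteq> x1"
    using cos_monotone_0_pi[of 0 1] pi_gt3 by (auto simp: x1_def vec_eq_iff forall_2)
  moreover have "v0 \<noteq> 0" "v1 \<noteq> 0"
    using unit_interval_trig(1)[of 1] by (auto simp: v0_def v1_def vec_eq_iff forall_2)
  ultimately show ?thesis by blast
qed

end
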